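(* Let $\beta\mathbb{N}$ be the Stone–Čech compactification of the discrete space $\mathbb{N}$ of natural numbers. In $C(\beta\mathbb{N})$, the product $A\cdot B$ of any two continuous intervals $A,B$ is an interval.
   Context: For a compact Hausdorff space $K$, $C(K)$ is the Banach algebra of continuous real functions on $K$ with the supremum norm. For $A,B\subset C(K)$, $A\cdot B=\{ab: a\in A,\ b\in B\}$ with pointwise products. An interval in $C(K)$ is a set of the form $[f,g]=\{h\in C(K): f\le h\le g\}$, where $f,g:K\to\mathbb{R}$ are bounded functions (not necessarily continuous) and inequalities between functions are pointwise; such a pair $f,g$ is called a representation of the interval. An interval is continuous if it has a representation $[f,g]$ with $f,g$ continuous. *)

theory Defs
  imports "HOL-Analysis.Analysis"
begin

text \<open>The Stone-Cech compactification of a space \<open>X\<close>, as the closure of the image of \<open>X\<close> under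
  its canonical evaluation map into the cube indexed by all continuous functions from \<open>X\<close> to the
  unit interval. The index set and the evaluation map are those of
  \<open>completely_regular_space_cube_embedding_explicit\<close>.\<close>

definition unit_functions :: "'a topology \<Rightarrow> ('a \<Rightarrow> real) set" where
  "unit_functions X =
     mspace (submetric (cfunspace X euclidean_metric) {f. f \<in> topspace X \<rightarrow> {0..1}})"

definition unit_cube :: "'a topology \<Rightarrow> (('a \<Rightarrow> real) \<Rightarrow> real) topology" where
  "unit_cube X = product_topology (\<lambda>f. top_of_set {0..1::real}) (unit_functions X)"

definition cube_eval :: "'a topology \<Rightarrow> 'a \<Rightarrow> ('a \<Rightarrow> real) \<Rightarrow> real" where
  "cube_eval X x = (\<lambda>f \<in> unit_functions X. f x)"

definition stone_cech :: "'a topology \<Rightarrow> (('a \<Rightarrow> real) \<Rightarrow> real) topology" where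
  "stone_cech X = subtopology (unit_cube X) (unit_cube X closure_of (cube_eval X ` topspace X))"

definition beta_nat :: "((nat \<Rightarrow> real) \<Rightarrow> real) topology" where
  "beta_nat = stone_cech (discrete_topology (UNIV :: nat set))"

lemma compact_space_unit_cube: "compact_space (unit_cube X)"
  unfolding unit_cube_def compact_space_product_topology
  by (intro disjI2 ballI compact_space_subtopology) simp

lemma compact_space_stone_cech: "compact_space (stone_cech X)"
  unfolding stone_cech_def
  by (intro compact_space_subtopology closedin_compact_space compact_space_unit_cube
      closedin_closure_of)

lemma Hausdorff_space_stone_cech: "Hausdorff_space (stone_cech X)"
  unfolding stone_cech_def unit_cube_def
  by (intro Hausdorff_space_subtopology Hausdorff_space_product_topology [THEN iffD2] disjI2 ballI
      Hausdorff_space_euclidean)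

lemma cube_eval_in_unit_cube: "cube_eval X ` topspace X \<subseteq> topspace (unit_cube X)"
proof (rule image_subsetI)
  fix x assume "x \<in> topspace X"
  moreover have "unit_functions X \<subseteq> {f. f \<in> topspace X \<rightarrow> {0..1}}"
    unfolding unit_functions_def mspace_submetric by (rule Int_lower1)
  ultimately have "f x \<in> {0..1}" if "f \<in> unit_functions X" for f
    using that by blast
  then show "cube_eval X x \<in> topspace (unit_cube X)"
    unfolding cube_eval_def unit_cube_def topspace_product_topology o_def topspace_euclidean_subtopology
    by (rule restrict_PiE_iff [THEN iffD2, OF ballI])
qed

lemma topspace_stone_cech:
  "topspace (stone_cech X) = unit_cube X closure_of (cube_eval X ` topspace X)"
  by (metis stone_cech_def closure_of_subset_topspace topspace_subtopology_subset)

lemma dense_in_stone_cech: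
  "stone_cech X closure_of (cube_eval X ` topspace X) = topspace (stone_cech X)"
proof -
  have "cube_eval X ` topspace X \<subseteq> unit_cube X closure_of (cube_eval X ` topspace X)"
    by (simp add: closure_of_subset cube_eval_in_unit_cube)
  then show ?thesis
    unfolding topspace_stone_cech
    by (simp add: stone_cech_def closure_of_subtopology Int_absorb1)
qed

lemma embedding_map_stone_cech:
  assumes "completely_regular_space X" "Hausdorff_space X"
  shows "embedding_map X (stone_cech X) (cube_eval X)"
proof -
  have "embedding_map X (unit_cube X) (cube_eval X)"
    using completely_regular_space_cube_embedding_explicit [OF assms]
    unfolding unit_cube_def cube_eval_def [abs_def] unit_functions_def .
  moreover have "cube_eval X ` topspace X \<subseteq> unit_cube X closure_of (cube_eval X ` topspace X)"
    by (simp add: closure_of_subset cube_eval_in_unit_cube)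
  ultimately show ?thesis
    by (simp add: stone_cech_def embedding_map_in_subtopology image_subset_iff_funcset)
qed

lemma stone_cech_extension:
  assumes "continuous_map X (top_of_set {0..1::real}) f"
  obtains F where "continuous_map (stone_cech X) (top_of_set {0..1}) F"
    and "\<And>x. x \<in> topspace X \<Longrightarrow> F (cube_eval X x) = f x"
proof -
  define f' where "f' = restrict f (topspace X)"
  have f01: "f ` topspace X \<subseteq> {0..1}" and cont: "continuous_map X euclideanreal f"
    using assms by (auto simp: continuous_map_in_subtopology)
  have "bounded (f ` topspace X)"
    using f01 bounded_closed_interval bounded_subset by blast
  then have f': "f' \<in> unit_functions X"
    using f01 cont by (auto simp: f'_def unit_functions_def)
  show thesis
  proof
    show "continuous_map (stone_cech X) (top_of_set {0..1}) (\<lambda>p. p f')"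
      unfolding stone_cech_def unit_cube_def
      by (rule continuous_map_from_subtopology) (rule continuous_map_product_projection [OF f'])
    show "cube_eval X x f' = f x" if "x \<in> topspace X" for x
      using that f' by (simp add: cube_eval_def f'_def)
  qed
qed

text \<open>For compact \<open>K\<close> the library's space of bounded continuous functions is \<open>C(K)\<close>. Its elements
  are \<open>extensional\<close>, i.e. \<open>undefined\<close> outside \<open>topspace K\<close>, which makes equality of functions
  on \<open>K\<close> coincide with equality in HOL.\<close>

abbreviation C_of :: "'a topology \<Rightarrow> ('a \<Rightarrow> real) set" where
  "C_of K \<equiv> mspace (cfunspace K euclidean_metric)"

lemma C_of_compact:
  "compact_space K \<Longrightarrow> C_of K = {h \<in> extensional (topspace K). continuous_map K euclideanreal h}"
  by (subst compactin_mspace_cfunspace) (auto simp: compact_space_def)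

definition set_product ::
  "'a topology \<Rightarrow> ('a \<Rightarrow> real) set \<Rightarrow> ('a \<Rightarrow> real) set \<Rightarrow> ('a \<Rightarrow> real) set" where
  "set_product K A B = {\<lambda>x\<in>topspace K. a x * b x | a b. a \<in> A \<and> b \<in> B}"

definition C_interval ::
  "'a topology \<Rightarrow> ('a \<Rightarrow> real) \<Rightarrow> ('a \<Rightarrow> real) \<Rightarrow> ('a \<Rightarrow> real) set" where
  "C_interval K f g = {h \<in> C_of K. \<forall>x\<in>topspace K. f x \<le> h x \<and> h x \<le> g x}"

text \<open>A representation \<open>[f,g]\<close> need not satisfy \<open>f \<le> g\<close>; in particular the empty set is an
  interval.\<close>

definition is_representation ::
  "'a topology \<Rightarrow> ('a \<Rightarrow> real) \<Rightarrow> ('a \<Rightarrow> real) \<Rightarrow> ('a \<Rightarrow> real) set \<Rightarrow> bool" where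
  "is_representation K f g A \<longleftrightarrow>
     bounded (f ` topspace K) \<and> bounded (g ` topspace K) \<and> A = C_interval K f g"

definition is_interval_C :: "'a topology \<Rightarrow> ('a \<Rightarrow> real) set \<Rightarrow> bool" where
  "is_interval_C K A \<longleftrightarrow> (\<exists>f g. is_representation K f g A)"

definition is_continuous_interval_C :: "'a topology \<Rightarrow> ('a \<Rightarrow> real) set \<Rightarrow> bool" where
  "is_continuous_interval_C K A \<longleftrightarrow>
     (\<exists>f g. is_representation K f g A \<and>
        continuous_map K euclideanreal f \<and> continuous_map K euclideanreal g)"

end

theory Submission
  imports Defs
begin

text \<open>A function on a discrete space extends continuously to the Stone-Cech compactification as soon
  as it is bounded, and identities and weak inequalities between continuous functions pass from the
  dense discrete part to the whole compactification. So a function lying between the pointwise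
  minimum and maximum of the four products of endpoints can be factored independently at each
  natural number, and the factors extended.\<close>

text \<open>An affine change of scale moves the values into the unit interval, where
  \<open>stone_cech_extension\<close> applies; the inverse affine map is then applied to the
  extension.\<close>

lemma stone_cech_extension_bounded:
  fixes f :: "'a \<Rightarrow> real"
  assumes f: "continuous_map X euclideanreal f" and bdd: "\<And>x. x \<in> topspace X \<Longrightarrow> \<bar>f x\<bar> \<le> M"
  obtains F where "continuous_map (stone_cech X) euclideanreal F"
    and "\<And>x. x \<in> topspace X \<Longrightarrow> F (cube_eval X x) = f x"
proof -
  \<comment> \<open>Adding 1 keeps the divisor \<open>2*C\<close> positive even for
    \<open>M = 0\<close>; from \<open>\<bar>f x\<bar> \<le> C\<close> the rescaled term lies within
    1/2 of the midpoint 1/2.\<close>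
  define C where "C = \<bar>M\<bar> + 1"
  have bC: "\<bar>f x\<bar> \<le> C" if "x \<in> topspace X" for x
    using bdd[OF that] by (simp add: C_def)
  have Cpos: "C > 0" by (simp add: C_def add_nonneg_pos)
  have "continuous_map X (top_of_set {0..1}) (\<lambda>x. 1/2 + (1/(2*C)) * f x)"
    unfolding continuous_map_in_subtopology
  proof
    show "continuous_map X euclideanreal (\<lambda>x. 1/2 + (1/(2*C)) * f x)"
      by (intro continuous_map_add continuous_map_real_mult f) auto
    show "(\<lambda>x. 1/2 + (1/(2*C)) * f x) \<in> topspace X \<rightarrow> {0..1}"
      using bC Cpos by (fastforce simp: divide_simps abs_le_iff)
  qed
  then obtain F where F: "continuous_map (stone_cech X) (top_of_set {0..1}) F"
    "\<And>x. x \<in> topspace X \<Longrightarrow> F (cube_eval X x) = 1/2 + (1/(2*C)) * f x"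
    by (rule stone_cech_extension) auto
  show thesis
  proof
    show "continuous_map (stone_cech X) euclideanreal (\<lambda>p. (2*C) * (F p - 1/2))"
      using F(1) by (intro continuous_map_real_mult continuous_map_diff)
        (auto simp: continuous_map_in_subtopology)
    show "(2*C) * (F (cube_eval X x) - 1/2) = f x" if "x \<in> topspace X" for x
      using Cpos by (simp add: F(2)[OF that])
  qed
qed

text \<open>The set where \<open>f \<le> g\<close> is the preimage of the closed half-line
  \<open>{0..}\<close> under the continuous map \<open>g - f\<close>, hence closed, and it contains
  a dense set.\<close>

lemma stone_cech_le:
  assumes f: "continuous_map (stone_cech X) euclideanreal f"
    and g: "continuous_map (stone_cech X) euclideanreal g"
    and le: "\<And>x. x \<in> topspace X \<Longrightarrow> f (cube_eval X x) \<le> g (cube_eval X x)"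
    and p: "p \<in> topspace (stone_cech X)"
  shows "f p \<le> g p"
proof -
  have "continuous_map (stone_cech X) euclideanreal (\<lambda>p. g p - f p)"
    by (intro continuous_map_diff f g)
  then have "closedin (stone_cech X) {p \<in> topspace (stone_cech X). g p - f p \<in> {0..}}"
    by (rule closedin_continuous_map_preimage) auto
  then have "closedin (stone_cech X) {p \<in> topspace (stone_cech X). f p \<le> g p}"
    by simp
  moreover have "p \<in> stone_cech X closure_of (cube_eval X ` topspace X)"
    using p by (simp add: dense_in_stone_cech)
  ultimately show ?thesis
    using forall_in_closure_of[of p "stone_cech X" "cube_eval X ` topspace X" "\<lambda>p. f p \<le> g p"] le
    by blast
qed

lemma stone_cech_eq:
  assumes "continuous_map (stone_cech X) euclideanreal f"
    and "continuous_map (stone_cech X) euclideanreal g"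
    and "\<And>x. x \<in> topspace X \<Longrightarrow> f (cube_eval X x) = g (cube_eval X x)"
    and "p \<in> topspace (stone_cech X)"
  shows "f p = g p"
  using stone_cech_le[of X f g p] stone_cech_le[of X g f p] assms by simp

text \<open>For \<open>a \<le> b\<close> and \<open>c \<le> d\<close> these two corner values are
  the endpoints of the product of the real intervals \<open>{a..b}\<close> and
  \<open>{c..d}\<close>. Being built from binary \<open>min\<close>, \<open>max\<close> and
  products, they depend continuously on the four endpoints.\<close>

definition min_corner :: "real \<Rightarrow> real \<Rightarrow> real \<Rightarrow> real \<Rightarrow> real" where
  "min_corner a b c d = min (min (a * c) (a * d)) (min (b * c) (b * d))"

definition max_corner :: "real \<Rightarrow> real \<Rightarrow> real \<Rightarrow> real \<Rightarrow> real" where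
  "max_corner a b c d = max (max (a * c) (a * d)) (max (b * c) (b * d))"

text \<open>For fixed \<open>y\<close>, multiplication by \<open>y\<close> is monotone or antitone
  according to the sign of \<open>y\<close>.\<close>

lemma mult_between_endpoints:
  fixes x :: real
  assumes "a \<le> x" "x \<le> b"
  shows "min (a * y) (b * y) \<le> x * y" "x * y \<le> max (a * y) (b * y)"
  using assms by (cases "y \<ge> 0"; 
      auto simp: min_le_iff_disj le_max_iff_disj mult_right_mono mult_right_mono_neg)+

text \<open>One factor is moved at a time: \<open>x * y\<close> lies between \<open>a * y\<close>
  and \<open>b * y\<close>, and each of these lies between two corner products.\<close>

lemma interval_mult_bounds:
  assumes "a \<le> x" "x \<le> b" "c \<le> y" "y \<le> d"
  shows "min_corner a b c d \<le> x * y" "x * y \<le> max_corner a b c d"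
proof -
  note 1 = mult_between_endpoints[OF assms(1,2), of y]
  note 2 = mult_between_endpoints[OF assms(3,4), of a, unfolded mult.commute[of _ a]]
  note 3 = mult_between_endpoints[OF assms(3,4), of b, unfolded mult.commute[of _ b]]
  show "min_corner a b c d \<le> x * y" "x * y \<le> max_corner a b c d"
    unfolding min_corner_def max_corner_def using 1 2 3 by linarith+
qed

text \<open>Multiplication is continuous on a connected rectangle, so its image contains everything
  between any two of its values, in particular between the smallest and largest corner
  products.\<close>

lemma interval_mult_surj:
  assumes "a \<le> b" "c \<le> d" "min_corner a b c d \<le> z" "z \<le> max_corner a b c d"
  obtains x y where "a \<le> x" "x \<le> b" "c \<le> y" "y \<le> d" "x * y = z"
proof -
  let ?S = "(\<lambda>(x, y). x * y) ` ({a..b} \<times> {c..d})"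
  have "connected ?S"
    by (intro connected_continuous_image connected_Times)
      (auto intro!: continuous_intros simp: case_prod_unfold)
  moreover have "a * c \<in> ?S" "a * d \<in> ?S" "b * c \<in> ?S" "b * d \<in> ?S"
    using assms(1,2) by force+
  then have "min_corner a b c d \<in> ?S" "max_corner a b c d \<in> ?S"
    unfolding min_corner_def max_corner_def min_def max_def by presburger+
  ultimately have "z \<in> ?S"
    using assms(3,4) by (meson connected_iff_interval)
  then show thesis
    using that by auto
qed

lemma bounded_continuous_image_compact_space:
  fixes f :: "'a \<Rightarrow> real"
  assumes "compact_space K" "continuous_map K euclideanreal f"
  shows "bounded (f ` topspace K)"
  using image_compactin[of K "topspace K" euclideanreal f] assms
  by (simp add: compact_space_def compact_imp_bounded)

text \<open>Discreteness enters in the second inclusion, where it makes any pointwise choice of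
  factors on \<open>S\<close> continuous. The order hypotheses make real factors available at each
  point; where endpoints cross, the left side is empty although the corner interval is not.\<close>

lemma set_product_C_interval_discrete:
  fixes S :: "'a set"
  defines "K \<equiv> stone_cech (discrete_topology S)"
  assumes f1: "continuous_map K euclideanreal f1" and g1: "continuous_map K euclideanreal g1"
    and f2: "continuous_map K euclideanreal f2" and g2: "continuous_map K euclideanreal g2"
    and le1: "\<And>p. p \<in> topspace K \<Longrightarrow> f1 p \<le> g1 p"
    and le2: "\<And>p. p \<in> topspace K \<Longrightarrow> f2 p \<le> g2 p"
  shows "set_product K (C_interval K f1 g1) (C_interval K f2 g2) =
    C_interval K (\<lambda>p. min_corner (f1 p) (g1 p) (f2 p) (g2 p))
      (\<lambda>p. max_corner (f1 p) (g1 p) (f2 p) (g2 p))"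
    (is "?L = ?R")
proof (intro equalityI subsetI)
  have K: "compact_space K"
    unfolding K_def by (rule compact_space_stone_cech)
  note C = C_of_compact[OF K]
  fix h assume "h \<in> ?L"
  then obtain a b where h: "h = (\<lambda>p\<in>topspace K. a p * b p)"
    and a: "a \<in> C_interval K f1 g1" and b: "b \<in> C_interval K f2 g2"
    unfolding set_product_def by blast
  have "continuous_map K euclideanreal (\<lambda>p. a p * b p)"
    using a b by (intro continuous_map_real_mult) (auto simp: C_interval_def C)
  then have "continuous_map K euclideanreal h"
    by (rule continuous_map_eq) (simp add: h)
  with a b show "h \<in> ?R"
    unfolding C_interval_def C by (auto simp: h interval_mult_bounds)
next
  have K: "compact_space K"
    unfolding K_def by (rule compact_space_stone_cech)
  note C = C_of_compact[OF K]
  let ?e = "cube_eval (discrete_topology S)"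
  have e: "?e n \<in> topspace K" if "n \<in> S" for n
    using dense_in_stone_cech[of "discrete_topology S"] closure_of_subset_topspace that
    by (metis K_def closure_of_subset cube_eval_in_unit_cube image_eqI subsetD topspace_discrete_topology
        topspace_stone_cech)
  fix h assume "h \<in> ?R"
  then have hext: "h \<in> extensional (topspace K)" and h: "continuous_map K euclideanreal h"
    and hb: "\<And>p. p \<in> topspace K \<Longrightarrow> min_corner (f1 p) (g1 p) (f2 p) (g2 p) \<le> h p"
      "\<And>p. p \<in> topspace K \<Longrightarrow> h p \<le> max_corner (f1 p) (g1 p) (f2 p) (g2 p)"
    by (auto simp: C_interval_def C)
  have "\<exists>x y. f1 (?e n) \<le> x \<and> x \<le> g1 (?e n) \<and> f2 (?e n) \<le> y \<and> y \<le> g2 (?e n) \<and> x * y = h (?e n)"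
    if "n \<in> S" for n
  proof -
    note p = e[OF that]
    show ?thesis
      by (rule interval_mult_surj[OF le1[OF p] le2[OF p] hb[OF p]]) blast
  qed
  \<comment> \<open>The choices at different points of \<open>S\<close> are unrelated to each
    other.\<close>
  then obtain u v where uv: "\<And>n. n \<in> S \<Longrightarrow> f1 (?e n) \<le> u n \<and> u n \<le> g1 (?e n) \<and>
      f2 (?e n) \<le> v n \<and> v n \<le> g2 (?e n) \<and> u n * v n = h (?e n)"
    by metis
  \<comment> \<open>The continuous bounds \<open>f\<close> and \<open>g\<close> serve twice:
    compactness makes them, and hence \<open>w\<close>, bounded, so that \<open>w\<close> extends;
    by density they also bound the extension.\<close>
  have ext: "\<exists>F. continuous_map K euclideanreal F \<and> (\<forall>n\<in>S. F (?e n) = w n) \<and>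
      (\<forall>p\<in>topspace K. f p \<le> F p \<and> F p \<le> g p)"
    if f: "continuous_map K euclideanreal f" and g: "continuous_map K euclideanreal g"
      and w: "\<And>n. n \<in> S \<Longrightarrow> f (?e n) \<le> w n \<and> w n \<le> g (?e n)" for f g w
  proof -
    obtain Mf where Mf: "\<And>p. p \<in> topspace K \<Longrightarrow> \<bar>f p\<bar> \<le> Mf"
      using bounded_continuous_image_compact_space[OF K f] by (auto simp: bounded_iff)
    obtain Mg where Mg: "\<And>p. p \<in> topspace K \<Longrightarrow> \<bar>g p\<bar> \<le> Mg"
      using bounded_continuous_image_compact_space[OF K g] by (auto simp: bounded_iff)
    have bw: "\<bar>w n\<bar> \<le> max Mf Mg" if "n \<in> S" for n
      using Mf[OF e[OF that]] Mg[OF e[OF that]] w[OF that] by linarith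
    obtain F where F: "continuous_map K euclideanreal F" "\<And>n. n \<in> S \<Longrightarrow> F (?e n) = w n"
      unfolding K_def
      by (rule stone_cech_extension_bounded[of "discrete_topology S" w "max Mf Mg"])
        (use bw in auto)
    have "f p \<le> F p" "F p \<le> g p" if "p \<in> topspace K" for p
      using stone_cech_le[of "discrete_topology S" f F p] stone_cech_le[of "discrete_topology S" F g p]
        f g F w that by (simp_all add: K_def)
    with F show ?thesis by blast
  qed
  obtain a where a: "continuous_map K euclideanreal a" "\<And>n. n \<in> S \<Longrightarrow> a (?e n) = u n"
    "\<And>p. p \<in> topspace K \<Longrightarrow> f1 p \<le> a p \<and> a p \<le> g1 p"
    using ext[OF f1 g1, of u] uv by blast
  obtain b where b: "continuous_map K euclideanreal b" "\<And>n. n \<in> S \<Longrightarrow> b (?e n) = v n"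
    "\<And>p. p \<in> topspace K \<Longrightarrow> f2 p \<le> b p \<and> b p \<le> g2 p"
    using ext[OF f2 g2, of v] uv by blast
  \<comment> \<open>Both sides are continuous and agree on the dense image of
    \<open>S\<close>.\<close>
  have "h p = a p * b p" if "p \<in> topspace K" for p
    using stone_cech_eq[of "discrete_topology S" h "\<lambda>p. a p * b p" p]
      h continuous_map_real_mult[OF a(1) b(1)] a(2) b(2) uv that by (simp add: K_def)
  \<comment> \<open>Members of \<open>C_of K\<close> are extensional, so the factors have to be
    restricted.\<close>
  then have "h = (\<lambda>p\<in>topspace K. restrict a (topspace K) p * restrict b (topspace K) p)"
    using hext by (auto simp: extensional_def)
  moreover have "restrict a (topspace K) \<in> C_interval K f1 g1"
    unfolding C_interval_def C
    using a(3) continuous_map_eq[OF a(1), of "restrict a (topspace K)"] by auto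
  moreover have "restrict b (topspace K) \<in> C_interval K f2 g2"
    unfolding C_interval_def C
    using b(3) continuous_map_eq[OF b(1), of "restrict b (topspace K)"] by auto
  ultimately show "h \<in> ?L"
    unfolding set_product_def by blast
qed

theorem proposition4p2:
  fixes A B :: "(((nat \<Rightarrow> real) \<Rightarrow> real) \<Rightarrow> real) set"
  assumes "is_continuous_interval_C beta_nat A"
    and "is_continuous_interval_C beta_nat B"
  shows "is_interval_C beta_nat (set_product beta_nat A B)"
proof -
  let ?K = beta_nat
  obtain f1 g1 where A: "A = C_interval ?K f1 g1"
    and fg1: "continuous_map ?K euclideanreal f1" "continuous_map ?K euclideanreal g1"
    using assms(1) by (auto simp: is_continuous_interval_C_def is_representation_def)
  obtain f2 g2 where B: "B = C_interval ?K f2 g2"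
    and fg2: "continuous_map ?K euclideanreal f2" "continuous_map ?K euclideanreal g2"
    using assms(2) by (auto simp: is_continuous_interval_C_def is_representation_def)
  have K: "compact_space ?K"
    unfolding beta_nat_def by (rule compact_space_stone_cech)
  \<comment> \<open>A point is needed to represent the empty set as an interval: the condition
    defining \<open>C_interval\<close> is vacuous on an empty space.\<close>
  have ne: "topspace ?K \<noteq> {}"
    using dense_in_stone_cech[of "discrete_topology (UNIV :: nat set)"]
    by (metis UNIV_not_empty beta_nat_def closure_of_eq_empty cube_eval_in_unit_cube image_is_empty
        topspace_discrete_topology topspace_stone_cech)
  show ?thesis
  proof (cases "A = {} \<or> B = {}")
    case True
    then have "set_product ?K A B = {}"
      by (auto simp: set_product_def)
    \<comment> \<open>Crossed constant bounds represent the empty product; the corner functions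
      would give a nonempty interval here.\<close>
    moreover have "C_interval ?K (\<lambda>_. 1) (\<lambda>_. 0) = {}"
    proof -
      obtain p where "p \<in> topspace ?K" using ne by blast
      then have "h \<notin> C_interval ?K (\<lambda>_. 1) (\<lambda>_. 0)" for h
        unfolding C_interval_def by force
      then show ?thesis by blast
    qed
    moreover have "bounded ((\<lambda>_. c) ` topspace ?K)" for c :: real
      by (simp add: image_constant_conv)
    ultimately show ?thesis
      unfolding is_interval_C_def is_representation_def by metis
  next
    case False
    \<comment> \<open>Any member of a nonempty interval lies between its endpoints everywhere, so
      these are ordered.\<close>
    then have "\<And>p. p \<in> topspace ?K \<Longrightarrow> f1 p \<le> g1 p" "\<And>p. p \<in> topspace ?K \<Longrightarrow> f2 p \<le> g2 p"
      unfolding A B C_interval_def by fastforce+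
    with fg1 fg2 have "set_product ?K A B = C_interval ?K
        (\<lambda>p. min_corner (f1 p) (g1 p) (f2 p) (g2 p))
        (\<lambda>p. max_corner (f1 p) (g1 p) (f2 p) (g2 p))"
      unfolding A B beta_nat_def by (rule set_product_C_interval_discrete)
    moreover have "continuous_map ?K euclideanreal (\<lambda>p. min_corner (f1 p) (g1 p) (f2 p) (g2 p))"
      "continuous_map ?K euclideanreal (\<lambda>p. max_corner (f1 p) (g1 p) (f2 p) (g2 p))"
      unfolding min_corner_def max_corner_def
      by (intro continuous_map_real_min continuous_map_real_max continuous_map_real_mult fg1 fg2)+
    ultimately show ?thesis
      unfolding is_interval_C_def is_representation_def
      by (blast intro: bounded_continuous_image_compact_space[OF K])
  qed
qed

end
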